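(* If $G$ is a Barycentric (that is, Barycentric refined) finite abstract simplicial complex, then the graphs $\phi(G)$ and $\psi(G)$ are homotopic.
   Context: A finite abstract simplicial complex $G$ is a finite set of finite non-empty sets closed under taking non-empty subsets. $\psi(G)$ is the finite simple graph with vertex set $G$ in which distinct $a,b$ are adjacent iff $a\cap b\neq\emptyset$; $\phi(G)$ is the finite simple graph with vertex set $G$ in which distinct $a,b$ are adjacent iff $a\subset b$ or $b\subset a$. The Whitney (clique) complex of a graph is the complex of all non-empty vertex sets of complete subgraphs. A complex $G$ is called Barycentric (a Barycentric refinement) if it is the Whitney complex of $\phi(H)$ for some finite abstract simplicial complex $H$. For a vertex $x$ of a finite simple graph, the unit sphere $S(x)$ is the subgraph induced by the neighbors of $x$. Contractible graphs are defined recursively: the one-point graph $K_1$ is contractible; a graph $B$ is contractible if there is a vertex $v$ such that both $S(v)$ and $B-v$ (the graph induced by the vertices other than $v$) are contractible. A homotopy step is either removing a vertex $v$ (with its edges) for which $S(v)$ is contractible, or the reverse: choosing a contractible (induced) subgraph $A$ of $B$ and adding a new vertex $v$ connected exactly to all vertices of $A$. Two finite simple graphs are homotopic if one is obtained from the other, up to isomorphism, by finitely many homotopy steps. *)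

theory Defs
  imports "Graph_Theory.Graph_Theory"
begin

text \<open>
  A finite simple graph is a \<^locale>\<open>pair_graph\<close>: finite vertex set, and the
  adjacency relation \<^const>\<open>parcs\<close> is symmetric, irreflexive and lives on the vertices.
\<close>

definition simplicial_complex :: "'a set set \<Rightarrow> bool" where
  "simplicial_complex G \<longleftrightarrow>
     finite G \<and> (\<forall>a\<in>G. finite a \<and> a \<noteq> {}) \<and> (\<forall>a\<in>G. \<forall>b. b \<subseteq> a \<and> b \<noteq> {} \<longrightarrow> b \<in> G)"

definition phi :: "'a set set \<Rightarrow> 'a set pair_pre_digraph" where
  "phi G = \<lparr>pverts = G, parcs = {(a, b). a \<in> G \<and> b \<in> G \<and> (a \<subset> b \<or> b \<subset> a)}\<rparr>"

definition psi :: "'a set set \<Rightarrow> 'a set pair_pre_digraph" where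
  "psi G = \<lparr>pverts = G, parcs = {(a, b). a \<in> G \<and> b \<in> G \<and> a \<noteq> b \<and> a \<inter> b \<noteq> {}}\<rparr>"

definition whitney_complex :: "'v pair_pre_digraph \<Rightarrow> 'v set set" where
  "whitney_complex B =
     {W. W \<noteq> {} \<and> W \<subseteq> pverts B \<and> (\<forall>u\<in>W. \<forall>v\<in>W. u \<noteq> v \<longrightarrow> (u, v) \<in> parcs B)}"

definition barycentric :: "'a set set set \<Rightarrow> bool" where
  "barycentric G \<longleftrightarrow> (\<exists>H. simplicial_complex H \<and> G = whitney_complex (phi H))"

definition induced_graph :: "'v pair_pre_digraph \<Rightarrow> 'v set \<Rightarrow> 'v pair_pre_digraph" where
  "induced_graph B W = \<lparr>pverts = pverts B \<inter> W, parcs = parcs B \<inter> W \<times> W\<rparr>"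

definition unit_sphere :: "'v pair_pre_digraph \<Rightarrow> 'v \<Rightarrow> 'v pair_pre_digraph" where
  "unit_sphere B x = induced_graph B {y. (x, y) \<in> parcs B}"

definition remove_vertex :: "'v pair_pre_digraph \<Rightarrow> 'v \<Rightarrow> 'v pair_pre_digraph" where
  "remove_vertex B v = induced_graph B (- {v})"

definition attach_vertex ::
  "'v pair_pre_digraph \<Rightarrow> 'v set \<Rightarrow> 'v \<Rightarrow> 'v pair_pre_digraph" where
  "attach_vertex B A v =
     \<lparr>pverts = insert v (pverts B), parcs = parcs B \<union> {v} \<times> A \<union> A \<times> {v}\<rparr>"

inductive contractible_graph :: "'v pair_pre_digraph \<Rightarrow> bool" where
  one_point: "contractible_graph \<lparr>pverts = {v}, parcs = {}\<rparr>"
| step: "pair_graph B \<Longrightarrow> v \<in> pverts B \<Longrightarrow> contractible_graph (unit_sphere B v) \<Longrightarrow>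
    contractible_graph (remove_vertex B v) \<Longrightarrow> contractible_graph B"

inductive homotopy_step :: "'v pair_pre_digraph \<Rightarrow> 'v pair_pre_digraph \<Rightarrow> bool" where
  remove: "pair_graph B \<Longrightarrow> v \<in> pverts B \<Longrightarrow> contractible_graph (unit_sphere B v) \<Longrightarrow>
    homotopy_step B (remove_vertex B v)"
| attach: "pair_graph B \<Longrightarrow> A \<subseteq> pverts B \<Longrightarrow> contractible_graph (induced_graph B A) \<Longrightarrow>
    v \<notin> pverts B \<Longrightarrow> homotopy_step B (attach_vertex B A v)"

text \<open>
  The steps are carried out on isomorphic copies with vertices in \<^typ>\<open>nat\<close>, so that a new
  vertex is always available even if the original vertex types are finite.
\<close>

definition homotopic_graphs :: "'v pair_pre_digraph \<Rightarrow> 'w pair_pre_digraph \<Rightarrow> bool" where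
  "homotopic_graphs A B \<longleftrightarrow>
     (\<exists>A' B' :: nat pair_pre_digraph.
        digraph_iso (with_proj A) (with_proj A') \<and> homotopy_step\<^sup>*\<^sup>* A' B' \<and>
        digraph_iso (with_proj B') (with_proj B))"

end

theory Submission
  imports Defs
begin

text \<open>
  Let \<open>G\<close> be the complex of chains of \<open>H\<close>, the simplices of \<open>H\<close> being ordered by inclusion. A
  chain \<open>c \<in> G\<close> has a least element, which is \<open>\<Inter>c\<close>. The proof compares the two graphs through the
  relation \<open>\<Inter>c \<subseteq> \<Inter>b\<close> between a vertex \<open>b\<close> of \<^term>\<open>phi G\<close> and a vertex \<open>c\<close> of \<^term>\<open>psi G\<close>.

  The general tool is a graph version of the comparison theorems of Dowker and Quillen
  (\<open>homotopic_graphs_by_relation\<close>): if a relation between the vertices of two finite graphs is such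
  that, for each non-empty clique of either graph, the vertices of the other graph related to the
  whole clique induce a contractible graph, then the two graphs are homotopic. Glue the disjoint
  union of the graphs along the relation. A vertex of one side has as its sphere some of its own
  side together with the vertices related to it, and by induction this is contractible; so the
  vertices of either side can be deleted one by one until only the other side is left.

  Two families of graphs must then be contractible.

  A clique of \<^term>\<open>psi G\<close> is a set \<open>F\<close> of pairwise intersecting chains. The largest element of a
  member of \<open>F\<close> contains the least element of every member, so the union \<open>m\<close> of these least
  elements is a simplex of \<open>H\<close>. The chains related to all of \<open>F\<close> are those that lie above \<open>m\<close>, and
  \<open>b \<mapsto> insert m b\<close> contracts them (\<open>contractible_chains_above\<close>).

  A clique of \<^term>\<open>phi G\<close> is a chain of chains. Its related chains are those with least element
  below a fixed simplex \<open>p\<close>, and they must be contracted in \<^term>\<open>psi G\<close>. Here a chain is moved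
  towards \<open>p\<close> by replacing some of its elements by an intersection with \<open>p\<close>, which keeps every
  needed common element; at the end all chains contain \<open>p\<close> and are pairwise adjacent
  (\<open>contractible_chains_starting_below\<close>).

  So the simplicial complex \<open>H\<close> enters only through two properties of its order: simplices inside
  a common simplex have a union in \<open>H\<close>, and those with a common non-empty part have an
  intersection in \<open>H\<close>. For the chains of an arbitrary poset the two graphs may differ: for the
  octahedron, with the three pairs of antipodes as the levels of a poset, any two maximal chains
  that are not complementary meet, which makes \<^term>\<open>psi G\<close> a 3-sphere up to homotopy.
\<close>

section \<open>Graphs given by a vertex set and a relation\<close>

text \<open>
  The edges join distinct related vertices, so reflexive relations are welcome; this makes
  \<open>\<forall>y. E v y \<longrightarrow> E w y\<close> the inclusion of closed neighbourhoods.
\<close>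
definition graph_on :: "'v set \<Rightarrow> ('v \<Rightarrow> 'v \<Rightarrow> bool) \<Rightarrow> 'v pair_pre_digraph" where
  "graph_on V E = \<lparr>pverts = V, parcs = {(x, y). x \<in> V \<and> y \<in> V \<and> x \<noteq> y \<and> E x y}\<rparr>"

lemma pverts_graph_on [simp]: "pverts (graph_on V E) = V"
  by (simp add: graph_on_def)

lemma graph_on_cong:
  assumes "V = V'" and "\<And>x y. x \<in> V' \<Longrightarrow> y \<in> V' \<Longrightarrow> E x y = E' x y"
  shows "graph_on V E = graph_on V' E'"
  using assms by (auto simp: graph_on_def)

lemma pair_graph_graph_on:
  assumes "finite V" and "symp E"
  shows "pair_graph (graph_on V E)"
proof
  show "finite (parcs (graph_on V E))"
    by (rule finite_subset[of _ "V \<times> V"]) (use assms in \<open>auto simp: graph_on_def\<close>)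
  show "symmetric (with_proj (graph_on V E))"
    using assms by (auto simp: symmetric_def graph_on_def sym_def dest: sympD)
qed (use assms in \<open>auto simp: graph_on_def\<close>)

lemma induced_graph_graph_on: "induced_graph (graph_on V E) W = graph_on (V \<inter> W) E"
  by (auto simp: induced_graph_def graph_on_def)

lemma unit_sphere_graph_on:
  "v \<in> V \<Longrightarrow> unit_sphere (graph_on V E) v = graph_on {y \<in> V. y \<noteq> v \<and> E v y} E"
  unfolding unit_sphere_def induced_graph_graph_on
  by (rule graph_on_cong) (auto simp: graph_on_def)

lemma remove_vertex_graph_on: "remove_vertex (graph_on V E) v = graph_on (V - {v}) E"
  by (simp add: remove_vertex_def induced_graph_graph_on Diff_eq)

section \<open>Contractible graphs\<close>

lemma contractible_graph_on_singleton: "contractible_graph (graph_on {v} E)"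
  using contractible_graph.one_point[of v] by (simp add: graph_on_def cong: conj_cong)

lemma contractible_graph_on_step:
  assumes "finite V" "symp E" "v \<in> V"
    and "contractible_graph (graph_on {y \<in> V. y \<noteq> v \<and> E v y} E)"
    and "contractible_graph (graph_on (V - {v}) E)"
  shows "contractible_graph (graph_on V E)"
  by (rule contractible_graph.step[of _ v])
    (use assms in
      \<open>simp_all add: pair_graph_graph_on unit_sphere_graph_on remove_vertex_graph_on\<close>)

text \<open>
  The spheres of the vertices other than the apex are again cones with the same apex.
\<close>
lemma contractible_cone:
  assumes "finite V" "symp E" "w \<in> V" "\<And>y. y \<in> V \<Longrightarrow> E w y"
  shows "contractible_graph (graph_on V E)"
  using assms
proof (induction "card V" arbitrary: V rule: less_induct)
  case less
  show ?case
  proof (cases "V = {w}")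
    case True
    then show ?thesis by (simp add: contractible_graph_on_singleton)
  next
    case False
    then obtain v where v: "v \<in> V" "v \<noteq> w" using less.prems by blast
    have "E v w" using less.prems v by (blast dest: sympD)
    then have "contractible_graph (graph_on {y \<in> V. y \<noteq> v \<and> E v y} E)"
      using v less.prems by (intro less.hyps) (auto intro!: psubset_card_mono)
    moreover have "contractible_graph (graph_on (V - {v}) E)"
      using v less.prems by (intro less.hyps card_Diff1_less) auto
    ultimately show ?thesis
      by (rule contractible_graph_on_step[OF less.prems(1,2) v(1)])
  qed
qed

text \<open>
  Dismantling: the vertices outside \<open>W\<close> are deleted in the order of increasing rank \<open>r\<close>. When \<open>v\<close>
  is deleted, its sphere is a cone, since its neighbours that are left are also neighbours of some
  vertex \<open>w\<close> that is left. Neighbours of smaller rank are already gone, hence need no care.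
\<close>
lemma contractible_by_dismantling:
  fixes r :: "'v \<Rightarrow> 'r :: linorder"
  assumes "finite V" "symp E" "W \<subseteq> V" "contractible_graph (graph_on W E)"
    and "\<And>v. v \<in> V - W \<Longrightarrow> \<exists>w\<in>V. (w \<in> W \<or> r v < r w) \<and> E v w \<and>
           (\<forall>y\<in>V. (y \<in> W \<or> r v \<le> r y) \<longrightarrow> E v y \<longrightarrow> E w y)"
  shows "contractible_graph (graph_on V E)"
  using assms(1,3,5)
proof (induction "card (V - W)" arbitrary: V rule: less_induct)
  case less
  note dominator = less.prems(3)
  show ?case
  proof (cases "V - W = {}")
    case True
    then have "V = W" using less.prems by blast
    then show ?thesis using assms by simp
  next
    case False
    have fin: "finite (V - W)" using less.prems by simp
    obtain v where v: "v \<in> V - W" "\<And>u. u \<in> V - W \<Longrightarrow> r v \<le> r u"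
      using ex_min_if_finite[of "r ` (V - W)"] fin False by (auto simp: not_less)
    obtain w where w: "w \<in> V" "w \<in> W \<or> r v < r w" "E v w"
        "\<And>y. y \<in> V \<Longrightarrow> y \<in> W \<or> r v \<le> r y \<Longrightarrow> E v y \<Longrightarrow> E w y"
      using dominator[OF v(1)] by blast
    have "w \<noteq> v" using v w by auto
    then have sphere: "contractible_graph (graph_on {y \<in> V. y \<noteq> v \<and> E v y} E)"
      using v w less.prems assms(2) by (intro contractible_cone[of _ _ w]) auto
    have "contractible_graph (graph_on (V - {v}) E)"
    proof (rule less.hyps)
      have "V - {v} - W \<subset> V - W" using v by auto
      then show "card (V - {v} - W) < card (V - W)" using fin psubset_card_mono by blast
      fix u assume u: "u \<in> V - {v} - W"
      then obtain z where z: "z \<in> V" "z \<in> W \<or> r u < r z" "E u z"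
          "\<And>y. y \<in> V \<Longrightarrow> y \<in> W \<or> r u \<le> r y \<Longrightarrow> E u y \<Longrightarrow> E z y"
        using dominator[of u] by blast
      have "r v \<le> r u" using u v by blast
      then have "z \<noteq> v" using z(2) v(1) by auto
      then show "\<exists>w\<in>V - {v}. (w \<in> W \<or> r u < r w) \<and> E u w \<and>
          (\<forall>y\<in>V - {v}. (y \<in> W \<or> r u \<le> r y) \<longrightarrow> E u y \<longrightarrow> E w y)"
        using z by blast
    qed (use less.prems v in auto)
    with sphere show ?thesis
      using contractible_graph_on_step[of V E v] less.prems(1) assms(2) v by blast
  qed
qed

lemma contractible_graph_inj_vimage:
  assumes "contractible_graph (graph_on (f ` V) E)" "inj_on f V" "symp E"
  shows "contractible_graph (graph_on V (\<lambda>x y. E (f x) (f y)))"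
  using assms(1,2)
proof (induction "graph_on (f ` V) E" arbitrary: V rule: contractible_graph.induct)
  case (one_point v)
  then have "f ` V = {v}" by (metis pair_pre_digraph.select_convs(1) pverts_graph_on)
  then obtain u where "u \<in> V" "f u = v" by blast
  then have "V = {u}" using \<open>f ` V = {v}\<close> one_point.prems by (auto dest: inj_onD)
  then show ?case by (simp add: contractible_graph_on_singleton)
next
  case (step v)
  have fin: "finite V"
    using pair_fin_digraph.pair_finite_verts[of "graph_on (f ` V) E"] step
    by (simp add: pair_graph_def pair_digraph_def finite_image_iff)
  obtain u where u: "u \<in> V" "v = f u" using step by auto
  have sphere: "unit_sphere (graph_on (f ` V) E) v
      = graph_on (f ` {y \<in> V. y \<noteq> u \<and> E (f u) (f y)}) E"
    using u step.prems
    by (subst unit_sphere_graph_on) (auto intro!: graph_on_cong dest: inj_onD)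
  have rest: "remove_vertex (graph_on (f ` V) E) v = graph_on (f ` (V - {u})) E"
    unfolding remove_vertex_graph_on
    using u step.prems by (intro graph_on_cong) (auto dest: inj_onD)
  have "contractible_graph
      (graph_on {y \<in> V. y \<noteq> u \<and> E (f u) (f y)} (\<lambda>x y. E (f x) (f y)))"
    by (rule step.hyps(4)[OF sphere]) (auto intro: inj_on_subset[OF step.prems])
  moreover have "contractible_graph (graph_on (V - {u}) (\<lambda>x y. E (f x) (f y)))"
    by (rule step.hyps(6)[OF rest]) (auto intro: inj_on_subset[OF step.prems])
  moreover have "symp (\<lambda>x y. E (f x) (f y))"
    by (rule sympI) (rule sympD[OF assms(3)])
  ultimately show ?case
    using contractible_graph_on_step[of V "\<lambda>x y. E (f x) (f y)" u] fin u(1) by simp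
qed

section \<open>Eliminating one side of a glued graph\<close>

definition clique :: "('v \<Rightarrow> 'v \<Rightarrow> bool) \<Rightarrow> 'v set \<Rightarrow> bool" where
  "clique E F \<longleftrightarrow> (\<forall>x\<in>F. \<forall>y\<in>F. x \<noteq> y \<longrightarrow> E x y)"

lemma clique_image:
  assumes "clique E F" and "\<And>x y. x \<in> F \<Longrightarrow> y \<in> F \<Longrightarrow> E' (g x) (g y) = E x y"
  shows "clique E' (g ` F)"
  using assms by (auto simp: clique_def)

text \<open>
  The sphere of a vertex \<open>x\<close> of \<open>X\<close> is a smaller graph of the same form, with \<open>Y\<close> replaced by the
  neighbours of \<open>x\<close> in \<open>Y\<close>: a clique \<open>F\<close> among the neighbours of \<open>x\<close> then gives the condition for
  \<open>insert x F\<close>. The empty clique says that \<open>Y\<close> itself is contractible.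
\<close>
lemma contractible_union:
  assumes "finite X" "finite Y" "symp E" "X \<inter> Y = {}"
    and "\<And>F. F \<subseteq> X \<Longrightarrow> clique E F \<Longrightarrow> contractible_graph (graph_on {y \<in> Y. \<forall>x\<in>F. E x y} E)"
  shows "contractible_graph (graph_on (X \<union> Y) E)"
  using assms(1,2,4,5)
proof (induction "card X" arbitrary: X Y rule: less_induct)
  case less
  note common = less.prems(4)
  show ?case
  proof (cases "X = {}")
    case True
    then show ?thesis using common[of "{}"] by (simp add: clique_def)
  next
    case False
    then obtain x where x: "x \<in> X" by blast
    let ?X = "{z \<in> X. z \<noteq> x \<and> E x z}" and ?Y = "{y \<in> Y. E x y}"
    have "contractible_graph (graph_on (?X \<union> ?Y) E)"
    proof (rule less.hyps)
      show "card ?X < card X" using x less.prems by (intro psubset_card_mono) auto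
      fix F assume F: "F \<subseteq> ?X" "clique E F"
      then have "clique E (insert x F)" using assms(3) by (auto simp: clique_def dest: sympD)
      moreover have "{y \<in> ?Y. \<forall>x\<in>F. E x y} = {y \<in> Y. \<forall>x\<in>insert x F. E x y}" by auto
      ultimately show "contractible_graph (graph_on {y \<in> ?Y. \<forall>x\<in>F. E x y} E)"
        using common[of "insert x F"] F x by auto
    qed (use less.prems in auto)
    moreover have "?X \<union> ?Y = {y \<in> X \<union> Y. y \<noteq> x \<and> E x y}" using less.prems x by auto
    moreover have "contractible_graph (graph_on ((X - {x}) \<union> Y) E)"
      using x less.prems by (intro less.hyps card_Diff1_less) auto
    moreover have "(X - {x}) \<union> Y = X \<union> Y - {x}" using less.prems x by auto
    ultimately show ?thesis
      using contractible_graph_on_step[of "X \<union> Y" E x] less.prems(1,2) x assms(3) by simp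
  qed
qed

lemma homotopy_steps_delete_vertex:
  assumes "finite V" "symp E" "x \<notin> V" "contractible_graph (graph_on {y \<in> V. E x y} E)"
  shows "homotopy_step (graph_on (insert x V) E) (graph_on V E)"
    and "homotopy_step (graph_on V E) (graph_on (insert x V) E)"
proof -
  let ?A = "{y \<in> V. E x y}"
  have sphere: "unit_sphere (graph_on (insert x V) E) x = graph_on ?A E"
    using assms by (subst unit_sphere_graph_on) (auto intro!: graph_on_cong)
  have "homotopy_step (graph_on (insert x V) E) (remove_vertex (graph_on (insert x V) E) x)"
    using assms sphere by (intro homotopy_step.remove) (auto simp: pair_graph_graph_on)
  then show "homotopy_step (graph_on (insert x V) E) (graph_on V E)"
    using assms by (simp add: remove_vertex_graph_on)
  have "induced_graph (graph_on V E) ?A = graph_on ?A E"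
    unfolding induced_graph_graph_on by (rule graph_on_cong) auto
  then have "homotopy_step (graph_on V E) (attach_vertex (graph_on V E) ?A x)"
    using assms by (intro homotopy_step.attach) (auto simp: pair_graph_graph_on)
  moreover have "attach_vertex (graph_on V E) ?A x = graph_on (insert x V) E"
    using assms by (auto simp: attach_vertex_def graph_on_def dest: sympD)
  ultimately show "homotopy_step (graph_on V E) (graph_on (insert x V) E)" by simp
qed

lemma homotopy_steps_eliminate_side:
  assumes "finite X" "finite Y" "symp E" "X \<inter> Y = {}"
    and "\<And>F. F \<subseteq> X \<Longrightarrow> F \<noteq> {} \<Longrightarrow> clique E F \<Longrightarrow>
           contractible_graph (graph_on {y \<in> Y. \<forall>x\<in>F. E x y} E)"
  shows "homotopy_step\<^sup>*\<^sup>* (graph_on (X \<union> Y) E) (graph_on Y E) \<and>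
         homotopy_step\<^sup>*\<^sup>* (graph_on Y E) (graph_on (X \<union> Y) E)"
  using assms(1,4,5)
proof (induction X rule: finite_induct)
  case empty
  then show ?case by simp
next
  case (insert x X)
  note common = insert.prems(2)
  have IH: "homotopy_step\<^sup>*\<^sup>* (graph_on (X \<union> Y) E) (graph_on Y E)"
      "homotopy_step\<^sup>*\<^sup>* (graph_on Y E) (graph_on (X \<union> Y) E)"
    using insert by auto
  let ?X = "{z \<in> X. E x z}" and ?Y = "{y \<in> Y. E x y}"
  have "contractible_graph (graph_on (?X \<union> ?Y) E)"
  proof (rule contractible_union)
    fix F assume F: "F \<subseteq> ?X" "clique E F"
    then have "clique E (insert x F)" using assms(3) by (auto simp: clique_def dest: sympD)
    moreover have "{y \<in> ?Y. \<forall>x\<in>F. E x y} = {y \<in> Y. \<forall>x\<in>insert x F. E x y}" by auto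
    moreover have "insert x F \<subseteq> insert x X" using F by auto
    ultimately show "contractible_graph (graph_on {y \<in> ?Y. \<forall>x\<in>F. E x y} E)"
      using common[of "insert x F"] by auto
  qed (use insert assms in auto)
  moreover have "?X \<union> ?Y = {y \<in> X \<union> Y. E x y}" by auto
  ultimately have *: "contractible_graph (graph_on {y \<in> X \<union> Y. E x y} E)" by simp
  have "finite (X \<union> Y)" "x \<notin> X \<union> Y" using insert assms by auto
  note steps = homotopy_steps_delete_vertex[OF this(1) assms(3) this(2) *]
  show ?case
    unfolding Un_insert_left
    by (rule conjI[OF converse_rtranclp_into_rtranclp[OF steps(1) IH(1)]
          rtranclp.rtrancl_into_rtrancl[OF IH(2) steps(2)]])
qed

lemma digraph_iso_graph_on:
  assumes "finite V" "symp E" "inj_on f V" "f ` V = V'"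
    and "\<And>x y. x \<in> V \<Longrightarrow> y \<in> V \<Longrightarrow> E x y = E' (f x) (f y)"
  shows "digraph_iso (with_proj (graph_on V E)) (with_proj (graph_on V' E'))"
proof -
  let ?f = "\<lparr>iso_verts = f, iso_arcs = map_prod f f, iso_head = snd, iso_tail = fst\<rparr>"
  have "pair_wf_digraph (graph_on V E)"
    using pair_graph_graph_on[OF assms(1,2)]
    by (simp add: pair_graph_def pair_digraph_def pair_fin_digraph_def)
  then have "wf_digraph (with_proj (graph_on V E))" by (simp add: wf_digraph_wp_iff)
  moreover have "inj_on (map_prod f f) (parcs (graph_on V E))"
    using assms(3) by (auto simp: inj_on_def graph_on_def)
  ultimately have "pre_digraph.digraph_isomorphism (with_proj (graph_on V E)) ?f"
    using assms(3) by (auto simp: pre_digraph.digraph_isomorphism_def)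
  moreover have "parcs (graph_on V' E') = map_prod f f ` parcs (graph_on V E)"
    unfolding graph_on_def assms(4)[symmetric]
    using assms(3,5) by (auto simp: image_iff inj_on_eq_iff)
  then have "with_proj (graph_on V' E') = app_iso ?f (with_proj (graph_on V E))"
    using assms(4) by (simp add: app_iso_def with_proj_def)
  ultimately show ?thesis unfolding digraph_iso_def by blast
qed

text \<open>
  The two graphs are numbered by \<open>{0..<n}\<close> and \<open>{n..<n + k}\<close> and glued along \<open>R\<close>; eliminating
  either interval of the glued graph leaves a copy of the other graph.
\<close>
theorem homotopic_graphs_by_relation:
  fixes V1 :: "'v set" and V2 :: "'w set" and R :: "'v \<Rightarrow> 'w \<Rightarrow> bool"
  assumes fin: "finite V1" "finite V2" and symp: "symp E1" "symp E2"
    and clique1: "\<And>F. F \<subseteq> V1 \<Longrightarrow> F \<noteq> {} \<Longrightarrow> clique E1 F \<Longrightarrow>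
           contractible_graph (graph_on {y \<in> V2. \<forall>x\<in>F. R x y} E2)"
    and clique2: "\<And>F. F \<subseteq> V2 \<Longrightarrow> F \<noteq> {} \<Longrightarrow> clique E2 F \<Longrightarrow>
           contractible_graph (graph_on {x \<in> V1. \<forall>y\<in>F. R x y} E1)"
  shows "homotopic_graphs (graph_on V1 E1) (graph_on V2 E2)"
proof -
  define n where "n = card V1"
  define N1 where "N1 = {0..<n}"
  define N2 where "N2 = {n..<n + card V2}"
  obtain g1 where g1: "bij_betw g1 N1 V1"
    using finite_same_card_bij[of N1 V1] fin by (auto simp: N1_def n_def)
  obtain g2 where g2: "bij_betw g2 N2 V2"
    using finite_same_card_bij[of N2 V2] fin by (auto simp: N2_def)
  define E where "E i j =
    (if i < n then if j < n then E1 (g1 i) (g1 j) else R (g1 i) (g2 j)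
     else if j < n then R (g1 j) (g2 i) else E2 (g2 i) (g2 j))" for i j
  have E: "symp E" using symp by (auto simp: E_def symp_def)
  have N: "finite N1" "finite N2" "N1 \<inter> N2 = {}" by (auto simp: N1_def N2_def)
  have E_simps: "\<And>i j. i \<in> N1 \<Longrightarrow> j \<in> N1 \<Longrightarrow> E i j = E1 (g1 i) (g1 j)"
      "\<And>i j. i \<in> N1 \<Longrightarrow> j \<in> N2 \<Longrightarrow> E i j = R (g1 i) (g2 j)"
      "\<And>i j. i \<in> N2 \<Longrightarrow> j \<in> N1 \<Longrightarrow> E i j = R (g1 j) (g2 i)"
      "\<And>i j. i \<in> N2 \<Longrightarrow> j \<in> N2 \<Longrightarrow> E i j = E2 (g2 i) (g2 j)"
    by (auto simp: E_def N1_def N2_def)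
  have common1: "contractible_graph (graph_on {j \<in> N2. \<forall>i\<in>F. E i j} E)"
    if F: "F \<subseteq> N1" "F \<noteq> {}" "clique E F" for F
  proof -
    let ?S = "{j \<in> N2. \<forall>i\<in>F. E i j}"
    have inj: "inj_on g2 ?S" using g2 by (auto simp: bij_betw_def intro: inj_on_subset)
    have "g2 ` ?S = {y \<in> V2. \<forall>x\<in>g1 ` F. R x y}"
      using E_simps(2)[OF subsetD[OF F(1)]] bij_betw_imp_surj_on[OF g2] by auto
    moreover have "clique E1 (g1 ` F)"
      using F by (intro clique_image[OF F(3)]) (auto intro!: E_simps(1)[symmetric])
    moreover have "g1 ` F \<subseteq> V1" using F g1 by (auto simp: bij_betw_def)
    ultimately have "contractible_graph (graph_on (g2 ` ?S) E2)"
      using clique1[of "g1 ` F"] F by auto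
    from contractible_graph_inj_vimage[OF this inj symp(2)] show ?thesis
      using graph_on_cong[of ?S ?S E "\<lambda>i j. E2 (g2 i) (g2 j)"] E_simps(4) by auto
  qed
  have common2: "contractible_graph (graph_on {j \<in> N1. \<forall>i\<in>F. E i j} E)"
    if F: "F \<subseteq> N2" "F \<noteq> {}" "clique E F" for F
  proof -
    let ?S = "{j \<in> N1. \<forall>i\<in>F. E i j}"
    have inj: "inj_on g1 ?S" using g1 by (auto simp: bij_betw_def intro: inj_on_subset)
    have "g1 ` ?S = {x \<in> V1. \<forall>y\<in>g2 ` F. R x y}"
      using E_simps(3)[OF subsetD[OF F(1)]] bij_betw_imp_surj_on[OF g1] by auto
    moreover have "clique E2 (g2 ` F)"
      using F by (intro clique_image[OF F(3)]) (auto intro!: E_simps(4)[symmetric])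
    moreover have "g2 ` F \<subseteq> V2" using F g2 by (auto simp: bij_betw_def)
    ultimately have "contractible_graph (graph_on (g1 ` ?S) E1)"
      using clique2[of "g2 ` F"] F by auto
    from contractible_graph_inj_vimage[OF this inj symp(1)] show ?thesis
      using graph_on_cong[of ?S ?S E "\<lambda>i j. E1 (g1 i) (g1 j)"] E_simps(1) by auto
  qed
  have "homotopy_step\<^sup>*\<^sup>* (graph_on N1 E) (graph_on (N2 \<union> N1) E)"
    by (rule homotopy_steps_eliminate_side[OF N(2,1) E _ common2, THEN conjunct2])
      (use N(3) in auto)
  also have "homotopy_step\<^sup>*\<^sup>* (graph_on (N2 \<union> N1) E) (graph_on N2 E)"
    unfolding Un_commute[of N2]
    by (rule homotopy_steps_eliminate_side[OF N(1,2) E N(3) common1, THEN conjunct1])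
  finally have "homotopy_step\<^sup>*\<^sup>* (graph_on N1 E) (graph_on N2 E)" .
  moreover have "digraph_iso (with_proj (graph_on V1 E1)) (with_proj (graph_on N1 E))"
  proof (rule digraph_iso_graph_on)
    let ?h = "inv_into N1 g1"
    show "inj_on ?h V1" "?h ` V1 = N1"
      using bij_betw_inv_into[OF g1] by (auto simp: bij_betw_def)
    fix x y assume "x \<in> V1" "y \<in> V1"
    then show "E1 x y = E (?h x) (?h y)"
      using g1 E_simps(1)[of "?h x" "?h y"]
      by (simp add: bij_betw_def f_inv_into_f inv_into_into)
  qed (use fin symp in auto)
  moreover have "digraph_iso (with_proj (graph_on N2 E)) (with_proj (graph_on V2 E2))"
    using g2 N E E_simps(4) by (intro digraph_iso_graph_on[of _ _ g2]) (auto simp: bij_betw_def)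
  ultimately show ?thesis unfolding homotopic_graphs_def by blast
qed

section \<open>Chains of simplices\<close>

definition comparable :: "'a set \<Rightarrow> 'a set \<Rightarrow> bool" where
  "comparable a b \<longleftrightarrow> a \<subseteq> b \<or> b \<subseteq> a"

lemma symp_comparable: "symp comparable"
  by (rule sympI) (auto simp: comparable_def)

lemma phi_eq_graph_on: "phi G = graph_on G comparable"
  by (auto simp: phi_def graph_on_def comparable_def)

lemma psi_eq_graph_on: "psi G = graph_on G (\<lambda>a b. a \<inter> b \<noteq> {})"
  by (auto simp: psi_def graph_on_def)

lemma symp_intersecting: "symp (\<lambda>a b. a \<inter> b \<noteq> {})"
  by (rule sympI) auto

lemma mem_chain_complex_iff:
  "c \<in> whitney_complex (phi H) \<longleftrightarrow> c \<noteq> {} \<and> c \<subseteq> H \<and> clique comparable c"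
  by (auto simp: whitney_complex_def phi_eq_graph_on graph_on_def clique_def)

lemma clique_comparableD: "clique comparable c \<Longrightarrow> x \<in> c \<Longrightarrow> y \<in> c \<Longrightarrow> x \<subseteq> y \<or> y \<subseteq> x"
  by (cases "x = y") (auto simp: clique_def comparable_def)

lemma clique_comparableI:
  "(\<And>x y. x \<in> c \<Longrightarrow> y \<in> c \<Longrightarrow> x \<subseteq> y \<or> y \<subseteq> x) \<Longrightarrow> clique comparable c"
  by (auto simp: clique_def comparable_def)

lemma chain_Inter_mem: "finite c \<Longrightarrow> c \<noteq> {} \<Longrightarrow> clique comparable c \<Longrightarrow> \<Inter>c \<in> c"
  by (rule Inter_in_chain[of _ UNIV])
    (simp_all add: subset_chain_def clique_comparableD)

lemma chain_Union_mem: "finite c \<Longrightarrow> c \<noteq> {} \<Longrightarrow> clique comparable c \<Longrightarrow> \<Union>c \<in> c"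
  by (rule Union_in_chain[of _ UNIV])
    (simp_all add: subset_chain_def clique_comparableD)

lemma simplicial_complexD:
  assumes "simplicial_complex H"
  shows "finite H" and "a \<in> H \<Longrightarrow> finite a" and "a \<in> H \<Longrightarrow> a \<noteq> {}"
    and "a \<in> H \<Longrightarrow> b \<subseteq> a \<Longrightarrow> b \<noteq> {} \<Longrightarrow> b \<in> H"
  using assms unfolding simplicial_complex_def by blast+

lemma finite_chain_complex: "finite H \<Longrightarrow> finite (whitney_complex (phi H))"
  by (rule finite_subset[of _ "Pow H"]) (auto simp: mem_chain_complex_iff)

section \<open>The chains starting below a simplex\<close>

text \<open>
  The rank of a chain \<open>c\<close> is the cardinality of its largest element \<open>k\<close> below \<open>p\<close>. If \<open>p \<notin> c\<close>, let
  \<open>J\<close> consist of the elements of \<open>c\<close> that meet \<open>p\<close> in more than \<open>k\<close>, and form \<open>c'\<close> from \<open>c\<close> by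
  replacing the elements strictly between \<open>k\<close> and \<open>J\<close> by the single simplex \<open>p \<inter> \<Inter>J\<close>, which is
  strictly above \<open>k\<close> and still below \<open>p\<close>. A chain \<open>f\<close> of rank at least that of \<open>c\<close> that meets \<open>c\<close>
  in a discarded element \<open>x\<close> has its own largest element below \<open>p\<close> inside \<open>x \<inter> p \<subseteq> k\<close>; by the rank
  this element is \<open>k\<close>, which \<open>c'\<close> retains. So \<open>c'\<close> dominates \<open>c\<close> once the chains of smaller rank
  are gone.
\<close>
lemma contractible_chains_starting_below:
  assumes H: "simplicial_complex H" and p: "p \<in> H"
  shows "contractible_graph
    (graph_on {c \<in> whitney_complex (phi H). \<Inter>c \<subseteq> p} (\<lambda>a b. a \<inter> b \<noteq> {}))"
proof -
  let ?V = "{c \<in> whitney_complex (phi H). \<Inter>c \<subseteq> p}"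
  let ?W = "{c \<in> whitney_complex (phi H). p \<in> c}"
  note H_simps = simplicial_complexD[OF H]
  define k where "k c = \<Union>{x \<in> c. x \<subseteq> p}" for c
  have finV: "finite ?V" using finite_chain_complex[OF H_simps(1)] by simp
  have finc: "finite c" if "c \<in> ?V" for c
    using that H_simps(1) by (auto simp: mem_chain_complex_iff intro: finite_subset)
  have finp: "finite p" using H_simps(2) p by blast
  have k_mem: "k c \<in> c" and k_sub: "k c \<subseteq> p" if c: "c \<in> ?V" for c
  proof -
    have "\<Inter>c \<in> c" using c finc[OF c] by (intro chain_Inter_mem) (auto simp: mem_chain_complex_iff)
    then have "k c \<in> {x \<in> c. x \<subseteq> p}" unfolding k_def using c finc[OF c]
      by (intro chain_Union_mem) (auto simp: mem_chain_complex_iff clique_def)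
    then show "k c \<in> c" "k c \<subseteq> p" by auto
  qed
  have k_max: "x \<subseteq> k c" if "x \<in> c" "x \<subseteq> p" for x c
    using that by (auto simp: k_def)
  show ?thesis
  proof (rule contractible_by_dismantling[of _ _ ?W "\<lambda>c. card (k c)"])
    show "?W \<subseteq> ?V" by auto
    have "{p} \<in> ?W" using p by (auto simp: mem_chain_complex_iff clique_def)
    then show "contractible_graph (graph_on ?W (\<lambda>a b. a \<inter> b \<noteq> {}))"
      using finite_subset[OF \<open>?W \<subseteq> ?V\<close> finV]
      by (intro contractible_cone[of _ _ "{p}"]) (auto intro: symp_intersecting)
    fix c assume "c \<in> ?V - ?W"
    then have c: "c \<in> ?V" and pc: "p \<notin> c" by auto
    have chain: "x \<subseteq> y \<or> y \<subseteq> x" if "x \<in> c" "y \<in> c" for x y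
      using c that clique_comparableD by (auto simp: mem_chain_complex_iff)
    define J where "J = {x \<in> c. \<not> x \<inter> p \<subseteq> k c}"
    define z where "z = p \<inter> \<Inter>J"
    define c' where "c' = {x \<in> c. x \<subseteq> p} \<union> {z} \<union> J"
    have k_less_J: "k c \<subseteq> x" if "x \<in> J" for x
      using chain[OF k_mem[OF c], of x] that by (auto simp: J_def)
    have kz: "k c \<subset> z"
    proof
      show "k c \<subseteq> z" using k_less_J k_sub[OF c] by (auto simp: z_def)
      show "k c \<noteq> z"
      proof (cases "J = {}")
        case True
        then show ?thesis using k_mem[OF c] pc by (auto simp: z_def)
      next
        case False
        then have "\<Inter>J \<in> J" using finc[OF c] c
          by (intro chain_Inter_mem) (auto simp: J_def mem_chain_complex_iff clique_def)
        then show ?thesis by (auto simp: J_def z_def)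
      qed
    qed
    have zp: "z \<subseteq> p" by (simp add: z_def)
    have zH: "z \<in> H" using H_simps(4)[OF p zp] kz by blast
    have low: "x \<subseteq> z" if "x \<in> c" "x \<subseteq> p" for x using k_max that kz by blast
    have high: "z \<subseteq> x" if "x \<in> J" for x using that by (auto simp: z_def)
    have "clique comparable c'"
    proof (rule clique_comparableI)
      fix x y assume "x \<in> c'" "y \<in> c'"
      then show "x \<subseteq> y \<or> y \<subseteq> x"
        using chain[of x y] low high by (auto simp: c'_def J_def)
    qed
    moreover have "c' \<noteq> {}" "c' \<subseteq> H" using c zH by (auto simp: c'_def J_def mem_chain_complex_iff)
    moreover have "\<Inter>c' \<subseteq> p" using zp by (auto simp: c'_def)
    ultimately have c': "c' \<in> ?V" by (simp add: mem_chain_complex_iff)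
    have kc': "k c \<in> c'" using k_mem[OF c] k_sub[OF c] by (simp add: c'_def)
    have "z \<subseteq> k c'" using zp by (intro k_max) (auto simp: c'_def)
    then have "k c \<subset> k c'" using kz by blast
    then have rank: "card (k c) < card (k c')"
      using psubset_card_mono finite_subset[OF k_sub[OF c'] finp] by blast
    have dominates: "c' \<inter> f \<noteq> {}"
      if f: "f \<in> ?V" and f_rank: "f \<in> ?W \<or> card (k c) \<le> card (k f)" and cf: "c \<inter> f \<noteq> {}" for f
    proof -
      obtain x where x: "x \<in> c" "x \<in> f" using cf by blast
      show ?thesis
      proof (cases "x \<in> c'")
        case True
        then show ?thesis using x by blast
      next
        case False
        then have xp: "\<not> x \<subseteq> p" and xk: "x \<inter> p \<subseteq> k c" using x by (auto simp: c'_def J_def)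
        have "k f \<subseteq> x \<or> x \<subseteq> k f"
          using clique_comparableD[OF _ k_mem[OF f] x(2)] f by (auto simp: mem_chain_complex_iff)
        then have "k f \<subseteq> x" using xp k_sub[OF f] by blast
        then have sub: "k f \<subseteq> k c" using xk k_sub[OF f] by blast
        have "card (k c) \<le> card (k f)"
          using f_rank
        proof
          assume "f \<in> ?W"
          then have "p \<subseteq> k f" by (intro k_max) auto
          then have "k f = p" using k_sub[OF f] by blast
          then show ?thesis using card_mono[OF finp k_sub[OF c]] by simp
        qed
        then have "k f = k c"
          using card_seteq[OF finite_subset[OF k_sub[OF c] finp] sub] by blast
        then show ?thesis using kc' k_mem[OF f] by auto
      qed
    qed
    show "\<exists>w\<in>?V. (w \<in> ?W \<or> card (k c) < card (k w)) \<and> c \<inter> w \<noteq> {} \<and>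
        (\<forall>y\<in>?V. (y \<in> ?W \<or> card (k c) \<le> card (k y)) \<longrightarrow> c \<inter> y \<noteq> {} \<longrightarrow> w \<inter> y \<noteq> {})"
    proof (intro bexI[OF _ c'] conjI ballI impI)
      show "c' \<in> ?W \<or> card (k c) < card (k c')" using rank by blast
      show "c \<inter> c' \<noteq> {}" using kc' k_mem[OF c] by blast
    qed (rule dominates)
  qed (use finV symp_intersecting in auto)
qed

section \<open>The chains lying above a simplex\<close>

text \<open>
  Deleting the larger chains first, one removes the chains without \<open>m\<close>: when \<open>b\<close> is deleted, all
  proper superchains of \<open>b\<close> that are left contain \<open>m\<close>, so \<open>insert m b\<close> dominates \<open>b\<close>. The rank is a
  negated cardinality for that reason. The chains containing \<open>m\<close> form a cone with apex \<open>{m}\<close>.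
\<close>
lemma contractible_chains_above:
  assumes "finite H" and m: "m \<in> H"
  shows "contractible_graph (graph_on {b \<in> whitney_complex (phi H). m \<subseteq> \<Inter>b} comparable)"
proof -
  let ?V = "{b \<in> whitney_complex (phi H). m \<subseteq> \<Inter>b}"
  let ?W = "{b \<in> ?V. m \<in> b}"
  have finV: "finite ?V" using finite_chain_complex[OF assms(1)] by simp
  show ?thesis
  proof (rule contractible_by_dismantling[of _ _ ?W "\<lambda>b. - int (card b)"])
    have "{m} \<in> ?W" using m by (auto simp: mem_chain_complex_iff clique_def)
    then show "contractible_graph (graph_on ?W comparable)"
      using finite_subset[OF _ finV, of ?W]
      by (intro contractible_cone[of _ _ "{m}"] symp_comparable) (auto simp: comparable_def)
    fix b assume "b \<in> ?V - ?W"
    then have b: "b \<in> ?V" by auto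
    have "clique comparable (insert m b)"
      using b by (intro clique_comparableI)
        (auto simp: mem_chain_complex_iff dest: clique_comparableD)
    then have w: "insert m b \<in> ?W" using b m by (auto simp: mem_chain_complex_iff)
    have dominates: "comparable (insert m b) f"
      if f: "f \<in> ?V" and f_rank: "f \<in> ?W \<or> - int (card b) \<le> - int (card f)"
        and bf: "comparable b f" for f
    proof (cases "f \<subseteq> b")
      case True
      then show ?thesis by (auto simp: comparable_def)
    next
      case False
      then have "b \<subset> f" using bf by (auto simp: comparable_def)
      moreover have "finite f"
        using f assms(1) by (auto simp: mem_chain_complex_iff intro: finite_subset)
      ultimately have "card b < card f" by (simp add: psubset_card_mono)
      then have "f \<in> ?W" using f_rank by auto
      then show ?thesis using \<open>b \<subset> f\<close> by (auto simp: comparable_def)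
    qed
    have w': "insert m b \<in> ?V" using w by blast
    show "\<exists>w\<in>?V. (w \<in> ?W \<or> - int (card b) < - int (card w)) \<and> comparable b w \<and>
        (\<forall>y\<in>?V. (y \<in> ?W \<or> - int (card b) \<le> - int (card y)) \<longrightarrow> comparable b y \<longrightarrow> comparable w y)"
    proof (intro bexI[OF _ w'] conjI ballI impI)
      show "insert m b \<in> ?W \<or> - int (card b) < - int (card (insert m b))" using w by blast
      show "comparable b (insert m b)" by (auto simp: comparable_def)
    qed (rule dominates)
  qed (use finV symp_comparable in auto)
qed

section \<open>The comparison\<close>

theorem theorem2:
  fixes G :: "'a set set set"
  assumes "simplicial_complex G" and "barycentric G"
  shows "homotopic_graphs (phi G) (psi G)"
proof -
  obtain H where H: "simplicial_complex H" and G: "G = whitney_complex (phi H)"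
    using assms(2) by (auto simp: barycentric_def)
  note H_simps = simplicial_complexD[OF H]
  have finG: "finite G" unfolding G by (rule finite_chain_complex[OF H_simps(1)])
  have memG: "c \<in> G \<longleftrightarrow> c \<noteq> {} \<and> c \<subseteq> H \<and> clique comparable c" for c
    unfolding G by (rule mem_chain_complex_iff)
  have finc: "finite c" if "c \<in> G" for c
    using that H_simps(1) by (auto simp: memG intro: finite_subset)
  have Inter_mem: "\<Inter>c \<in> c" if "c \<in> G" for c
    using chain_Inter_mem[OF finc[OF that]] that by (simp add: memG)
  show ?thesis
    unfolding phi_eq_graph_on psi_eq_graph_on
  proof (rule homotopic_graphs_by_relation[where R = "\<lambda>b c. \<Inter>c \<subseteq> \<Inter>b"])
    fix F assume F: "F \<subseteq> G" "F \<noteq> {}" "clique comparable F"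
    have "\<Union>F \<in> G" using chain_Union_mem[OF finite_subset[OF F(1) finG] F(2,3)] F(1) by blast
    then have "\<Inter>(\<Union>F) \<in> H" using Inter_mem[of "\<Union>F"] by (auto simp: memG)
    moreover have "{c \<in> G. \<forall>b\<in>F. \<Inter>c \<subseteq> \<Inter>b} = {c \<in> G. \<Inter>c \<subseteq> \<Inter>(\<Union>F)}" by blast
    ultimately show "contractible_graph
        (graph_on {c \<in> G. \<forall>b\<in>F. \<Inter>c \<subseteq> \<Inter>b} (\<lambda>a b. a \<inter> b \<noteq> {}))"
      using contractible_chains_starting_below[OF H] by (simp add: G)
  next
    fix F assume F: "F \<subseteq> G" "F \<noteq> {}" "clique (\<lambda>a b. a \<inter> b \<noteq> {}) F"
    define m where "m = (\<Union>c\<in>F. \<Inter>c)"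
    obtain d where d: "d \<in> F" using F by blast
    \<comment> \<open>The largest element of any single member of \<open>F\<close> bounds all least elements.\<close>
    have top: "\<Union>d \<in> H" using chain_Union_mem[of d] finc[of d] d F(1) memG[of d] by blast
    have "\<Inter>c \<subseteq> \<Union>d" if "c \<in> F" for c
    proof -
      have "c \<inter> d \<noteq> {}" using F d that by (cases "c = d") (auto simp: clique_def memG)
      then show ?thesis by blast
    qed
    then have "m \<subseteq> \<Union>d" by (auto simp: m_def)
    moreover have "d \<in> G" using d F(1) by blast
    then have "\<Inter>d \<in> H" using Inter_mem memG by blast
    then have "\<Inter>d \<noteq> {}" by (rule H_simps(3))
    then have "m \<noteq> {}" using d by (auto simp: m_def)
    ultimately have "m \<in> H" using H_simps(4) top by blast
    moreover have "{b \<in> G. \<forall>c\<in>F. \<Inter>c \<subseteq> \<Inter>b} = {b \<in> G. m \<subseteq> \<Inter>b}"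
      unfolding m_def by blast
    ultimately show "contractible_graph (graph_on {b \<in> G. \<forall>c\<in>F. \<Inter>c \<subseteq> \<Inter>b} comparable)"
      using contractible_chains_above[OF H_simps(1)] by (simp add: G)
  qed (use finG symp_comparable symp_intersecting in auto)
qed

end
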